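(* Let $\Omega\subset\mathbb{H}$ be open and convex, and let $u:\Omega\to\mathbb{R}$. Then $u$ is convex if and only if $\partial_H u(g)\neq\emptyset$ for every $g\in\Omega$.
   Context: The Heisenberg group $\mathbb{H}$ is $\mathbb{R}^3$ with the group law $(x,y,t)(x',y',t')=(x+x',\,y+y',\,t+t'+2(x'y-xy'))$, identity $e=(0,0,0)$, and dilations $\delta_\lambda(x,y,t)=(\lambda x,\lambda y,\lambda^2 t)$. Let $X=\partial_x+2y\,\partial_t$, $Y=\partial_y-2x\,\partial_t$ and $V_1=\mathrm{span}\{X,Y\}$, with the inner product $\langle\cdot,\cdot\rangle$ for which $X,Y$ are orthonormal. For $v=\alpha X+\beta Y\in V_1$, $\exp(v)=(\alpha,\beta,0)$; and $\xi_1(x,y,t)=xX+yY\in V_1$. For $g_0=(x_0,y_0,t_0)\in\mathbb{H}$ the horizontal plane at $g_0$ is $H_{g_0}=\{g_0\exp(v): v\in V_1\}=\{(x,y,t): t=t_0+2y_0x-2x_0y\}$. A set $\Omega\subset\mathbb{H}$ is convex if for every $g\in\Omega$ and $g'\in H_g\cap\Omega$ one has $g\delta_\lambda(g^{-1}g')\in\Omega$ for all $\lambda\in[0,1]$. A function $u:\Omega\to\mathbb{R}$ on a convex set $\Omega$ is convex if $u(g\delta_\lambda(g^{-1}g'))\le u(g)+\lambda(u(g')-u(g))$ for all $g\in\Omega$, $g'\in H_g\cap\Omega$, $\lambda\in[0,1]$. The H-subdifferential of $u:\Omega\to\mathbb{R}$ at $g_0\in\Omega$ is $\partial_H u(g_0)=\{p\in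 V_1:\ u(g)\ge u(g_0)+\langle p,\xi_1(g)-\xi_1(g_0)\rangle\ \ \forall g\in H_{g_0}\cap\Omega\}$. *)

theory Defs
  imports "HOL-Analysis.Analysis"
begin

text \<open>
  The Heisenberg group is carried by \<open>\<real>\<^sup>3\<close>, written as a product type so that \<^const>\<open>open\<close> is
  the Euclidean topology.  The componentwise \<open>+\<close> of that type is not the group operation.
\<close>

type_synonym heis = "real \<times> real \<times> real"

definition heis_mult :: "heis \<Rightarrow> heis \<Rightarrow> heis" (infixl "\<odot>" 70) where
  "g \<odot> g' = (case g of (x, y, t) \<Rightarrow> case g' of (x', y', t') \<Rightarrow>
     (x + x', y + y', t + t' + 2 * (x' * y - x * y')))"

definition heis_e :: heis where
  "heis_e = (0, 0, 0)"

definition heis_inv :: "heis \<Rightarrow> heis" where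
  "heis_inv g = (case g of (x, y, t) \<Rightarrow> (- x, - y, - t))"

definition heis_dil :: "real \<Rightarrow> heis \<Rightarrow> heis" where
  "heis_dil l g = (case g of (x, y, t) \<Rightarrow> (l * x, l * y, l\<^sup>2 * t))"

lemma heis_mult_simp [simp]:
  "(x, y, t) \<odot> (x', y', t') = (x + x', y + y', t + t' + 2 * (x' * y - x * y'))"
  by (simp add: heis_mult_def)

lemma heis_inv_simp [simp]: "heis_inv (x, y, t) = (- x, - y, - t)"
  by (simp add: heis_inv_def)

lemma heis_dil_simp [simp]: "heis_dil l (x, y, t) = (l * x, l * y, l\<^sup>2 * t)"
  by (simp add: heis_dil_def)

lemma heis_mult_assoc: "(a \<odot> b) \<odot> c = a \<odot> (b \<odot> c)"
  by (cases a; cases b; cases c) (simp add: algebra_simps)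

lemma heis_e_left: "heis_e \<odot> g = g" and heis_e_right: "g \<odot> heis_e = g"
  by (cases g; simp add: heis_e_def)+

lemma heis_inv_left: "heis_inv g \<odot> g = heis_e" and heis_inv_right: "g \<odot> heis_inv g = heis_e"
  by (cases g; simp add: heis_e_def)+

text \<open>
  A vector field \<open>a \<partial>\<^sub>x + b \<partial>\<^sub>y + c \<partial>\<^sub>t\<close> is given by its coefficient functions
  \<open>g \<mapsto> (a g, b g, c g)\<close>.
\<close>

type_synonym vfield = "heis \<Rightarrow> real \<times> real \<times> real"

definition X_field :: vfield where
  "X_field = (\<lambda>(x, y, t). (1, 0, 2 * y))"

definition Y_field :: vfield where
  "Y_field = (\<lambda>(x, y, t). (0, 1, - 2 * x))"

definition hfield :: "real \<Rightarrow> real \<Rightarrow> vfield" where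
  "hfield a b = (\<lambda>g. a *\<^sub>R X_field g + b *\<^sub>R Y_field g)"

definition V1 :: "vfield set" where
  "V1 = {hfield a b | a b. True}"

text \<open>
  At \<open>e\<close> the fields \<open>X\<close> and \<open>Y\<close> have values \<open>(1, 0, 0)\<close> and \<open>(0, 1, 0)\<close>, so the
  coordinates of \<open>v \<in> V\<^sub>1\<close> in the basis \<open>X, Y\<close> can be read off from \<open>v e\<close>.
\<close>

definition X_coord :: "vfield \<Rightarrow> real" where
  "X_coord v = fst (v heis_e)"

definition Y_coord :: "vfield \<Rightarrow> real" where
  "Y_coord v = fst (snd (v heis_e))"

lemma X_coord_hfield [simp]: "X_coord (hfield a b) = a"
  and Y_coord_hfield [simp]: "Y_coord (hfield a b) = b"
  by (simp_all add: X_coord_def Y_coord_def hfield_def X_field_def Y_field_def heis_e_def)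

definition V1_inner :: "vfield \<Rightarrow> vfield \<Rightarrow> real" where
  "V1_inner v w = X_coord v * X_coord w + Y_coord v * Y_coord w"

lemma V1_inner_orthonormal:
  "V1_inner X_field X_field = 1" "V1_inner Y_field Y_field = 1" "V1_inner X_field Y_field = 0"
  by (simp_all add: V1_inner_def X_coord_def Y_coord_def X_field_def Y_field_def heis_e_def)

lemma V1_inner_hfield [simp]: "V1_inner (hfield a b) (hfield c d) = a * c + b * d"
  by (simp add: V1_inner_def)

definition heis_exp :: "vfield \<Rightarrow> heis" where
  "heis_exp v = (X_coord v, Y_coord v, 0)"

lemma heis_exp_hfield [simp]: "heis_exp (hfield a b) = (a, b, 0)"
  by (simp add: heis_exp_def)

definition xi1 :: "heis \<Rightarrow> vfield" where
  "xi1 g = (case g of (x, y, t) \<Rightarrow> hfield x y)"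

lemma xi1_diff: "xi1 (x, y, t) - xi1 (x0, y0, t0) = hfield (x - x0) (y - y0)"
  by (simp add: xi1_def hfield_def fun_eq_iff scaleR_left_diff_distrib)

definition hplane :: "heis \<Rightarrow> heis set" where
  "hplane g0 = {g0 \<odot> heis_exp v | v. v \<in> V1}"

lemma hplane_eq: "hplane (x0, y0, t0) = {(x, y, t). t = t0 + 2 * y0 * x - 2 * x0 * y}"
proof (intro set_eqI iffI)
  fix g assume "g \<in> hplane (x0, y0, t0)"
  then show "g \<in> {(x, y, t). t = t0 + 2 * y0 * x - 2 * x0 * y}"
    by (auto simp: hplane_def V1_def algebra_simps)
next
  fix g assume "g \<in> {(x, y, t). t = t0 + 2 * y0 * x - 2 * x0 * y}"
  then obtain x y where g: "g = (x, y, t0 + 2 * y0 * x - 2 * x0 * y)"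
    by auto
  have "g = (x0, y0, t0) \<odot> heis_exp (hfield (x - x0) (y - y0))"
    by (simp add: g algebra_simps)
  moreover have "hfield (x - x0) (y - y0) \<in> V1"
    by (auto simp: V1_def)
  ultimately show "g \<in> hplane (x0, y0, t0)"
    unfolding hplane_def by blast
qed

definition hconvex_set :: "heis set \<Rightarrow> bool" where
  "hconvex_set \<Omega> \<longleftrightarrow>
     (\<forall>g\<in>\<Omega>. \<forall>g'\<in>hplane g \<inter> \<Omega>. \<forall>l\<in>{0..1}. g \<odot> heis_dil l (heis_inv g \<odot> g') \<in> \<Omega>)"

text \<open>
  A function on \<open>\<Omega>\<close> is a total function of which only the values on \<open>\<Omega>\<close> are used.
  Convexity of \<open>\<Omega>\<close> itself is not part of the next definition.
\<close>

definition hconvex_on :: "heis set \<Rightarrow> (heis \<Rightarrow> real) \<Rightarrow> bool" where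
  "hconvex_on \<Omega> u \<longleftrightarrow>
     (\<forall>g\<in>\<Omega>. \<forall>g'\<in>hplane g \<inter> \<Omega>. \<forall>l\<in>{0..1}.
        u (g \<odot> heis_dil l (heis_inv g \<odot> g')) \<le> u g + l * (u g' - u g))"

definition hsubdiff :: "heis set \<Rightarrow> (heis \<Rightarrow> real) \<Rightarrow> heis \<Rightarrow> vfield set" where
  "hsubdiff \<Omega> u g0 =
     {p \<in> V1. \<forall>g\<in>hplane g0 \<inter> \<Omega>. u g \<ge> u g0 + V1_inner p (xi1 g - xi1 g0)}"

end

theory Submission
  imports Defs
begin

text \<open>
  Subgradients give convexity because \<open>g\<close> and \<open>g'\<close> both lie in the horizontal plane of every point
  of the horizontal segment joining them.

  Conversely, no regularity of a convex \<open>u\<close> is assumed, and \<open>u\<close> is convex on a horizontal plane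
  only along the lines through its base point, so continuity comes first.  Sublevel sets of \<open>u\<close>
  are convex, and the convex hull of suitable finite sets contains a neighbourhood of the
  identity; hence \<open>u\<close> is locally bounded above, and a Harnack inequality makes it continuous.
  Minimising \<open>u + n |g|\<^sup>2\<close> near the identity then gives points converging to the identity at
  which \<open>u\<close> is touched from below by a smooth function and therefore has a subgradient.  These
  subgradients are bounded and accumulate at a subgradient at the identity.  Left translation
  carries this to all points.
\<close>

section \<open>Group cancellation and the definitions in horizontal coordinates\<close>

lemma heis_inv_mult_cancel: "heis_inv g \<odot> (g \<odot> h) = h"
  by (simp flip: heis_mult_assoc add: heis_inv_left heis_e_left)

lemma heis_mult_inv_cancel: "g \<odot> (heis_inv g \<odot> h) = h"
  by (simp flip: heis_mult_assoc add: heis_inv_right heis_e_left)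

lemma heis_e_eq_zero: "heis_e = 0"
  by (simp add: heis_e_def zero_prod_def)

lemma hplane_eq_image: "hplane g = {g \<odot> (a, b, 0) | a b. True}"
  unfolding hplane_def by (auto simp: V1_def) (metis heis_exp_hfield)+

lemma ball_hplane:
  "(\<forall>h\<in>hplane g \<inter> \<Omega>. P h) \<longleftrightarrow> (\<forall>a b. g \<odot> (a, b, 0) \<in> \<Omega> \<longrightarrow> P (g \<odot> (a, b, 0)))"
  unfolding hplane_eq_image by blast

text \<open>Writing \<open>g' = g \<odot> (a, b, 0)\<close> cancels \<open>g\<close>, and a dilation
  acts on a point with zero last coordinate by plain scaling.\<close>

lemma hconvex_set_iff:
  "hconvex_set \<Omega> \<longleftrightarrow>
     (\<forall>g\<in>\<Omega>. \<forall>a b. g \<odot> (a, b, 0) \<in> \<Omega> \<longrightarrow> (\<forall>l\<in>{0..1}. g \<odot> (l * a, l * b, 0) \<in> \<Omega>))"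
  by (simp add: hconvex_set_def ball_hplane heis_inv_mult_cancel)

lemma hconvex_on_iff:
  "hconvex_on \<Omega> u \<longleftrightarrow>
     (\<forall>g\<in>\<Omega>. \<forall>a b. g \<odot> (a, b, 0) \<in> \<Omega> \<longrightarrow>
        (\<forall>l\<in>{0..1}. u (g \<odot> (l * a, l * b, 0)) \<le> u g + l * (u (g \<odot> (a, b, 0)) - u g)))"
  by (simp add: hconvex_on_def ball_hplane heis_inv_mult_cancel)

text \<open>\<open>xi1\<close> sees only the first two coordinates, which add under the group law,
  so an element of the subdifferential is a pair of slopes \<open>p\<close>,
  \<open>q\<close>.\<close>

lemma hsubdiff_nonempty_iff:
  "hsubdiff \<Omega> u g \<noteq> {} \<longleftrightarrow>
     (\<exists>p q. \<forall>a b. g \<odot> (a, b, 0) \<in> \<Omega> \<longrightarrow> u (g \<odot> (a, b, 0)) \<ge> u g + p * a + q * b)"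
proof -
  have "xi1 (g \<odot> (a, b, 0)) - xi1 g = hfield a b" for a b
    by (cases g) (simp add: xi1_diff)
  then have "hfield p q \<in> hsubdiff \<Omega> u g \<longleftrightarrow>
      (\<forall>a b. g \<odot> (a, b, 0) \<in> \<Omega> \<longrightarrow> u (g \<odot> (a, b, 0)) \<ge> u g + p * a + q * b)" for p q
    unfolding hsubdiff_def mem_Collect_eq ball_hplane by (auto simp: V1_def algebra_simps)
  moreover have "hsubdiff \<Omega> u g \<subseteq> V1"
    by (auto simp: hsubdiff_def)
  ultimately show ?thesis
    unfolding V1_def by blast
qed

section \<open>Convexity along horizontal lines and under left translation\<close>

text \<open>The twist in the group law vanishes for parallel horizontal vectors, so displacements
  along one line add. Rebasing at the end \<open>w \<odot> (- a, - b, 0)\<close> with parameter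
  \<open>(1 + s) / 2\<close> gives the form centred at \<open>w\<close>.\<close>

lemma hconvex_set_segment:
  assumes "hconvex_set S" "w \<odot> (a, b, 0) \<in> S" "w \<odot> (- a, - b, 0) \<in> S" "\<bar>s\<bar> \<le> 1"
  shows "w \<odot> (s * a, s * b, 0) \<in> S"
proof -
  obtain x y t where w: "w = (x, y, t)" by (cases w)
  have "w \<odot> (- a, - b, 0) \<odot> (2 * a, 2 * b, 0) = w \<odot> (a, b, 0)"
    by (simp add: w algebra_simps)
  moreover have "w \<odot> (- a, - b, 0) \<odot> ((1 + s) / 2 * (2 * a), (1 + s) / 2 * (2 * b), 0)
      = w \<odot> (s * a, s * b, 0)"
    by (simp add: w field_simps)
  moreover have "(1 + s) / 2 \<in> {0..1}"
    using assms(4) by (auto simp: abs_le_iff)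
  ultimately show ?thesis
    using assms(1-3) unfolding hconvex_set_iff by metis
qed

text \<open>Here \<open>w\<close> divides the segment between the two points with weights
  \<open>m / (1 + m)\<close> and \<open>1 / (1 + m)\<close>. Large \<open>m\<close> lets a far point
  on one side control \<open>u\<close> at a near point on the other.\<close>

lemma hconvex_on_between:
  assumes "hconvex_on \<Omega> u" "w \<odot> (a, b, 0) \<in> \<Omega>" "w \<odot> (- m * a, - m * b, 0) \<in> \<Omega>" "m \<ge> 0"
  shows "(1 + m) * u w \<le> m * u (w \<odot> (a, b, 0)) + u (w \<odot> (- m * a, - m * b, 0))"
proof -
  obtain x y t where w: "w = (x, y, t)" by (cases w)
  define c d where "c = - (1 + m) * a" and "d = - (1 + m) * b"
  have 1: "w \<odot> (a, b, 0) \<odot> (c, d, 0) = w \<odot> (- m * a, - m * b, 0)"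
    by (simp add: w c_def d_def algebra_simps)
  have "1 / (1 + m) * c = - a" "1 / (1 + m) * d = - b"
    using assms(4) by (simp_all add: c_def d_def field_simps)
  then have 2: "w \<odot> (a, b, 0) \<odot> (1 / (1 + m) * c, 1 / (1 + m) * d, 0) = w"
    by (simp only:) (simp add: w algebra_simps)
  have "1 / (1 + m) \<in> {0..1}"
    using assms(4) by (auto simp: divide_simps)
  then have "u w \<le> u (w \<odot> (a, b, 0))
      + 1 / (1 + m) * (u (w \<odot> (- m * a, - m * b, 0)) - u (w \<odot> (a, b, 0)))"
    using assms 1 2 unfolding hconvex_on_iff by metis
  then show ?thesis
    using assms(4) by (simp add: field_simps)
qed

lemma hconvex_set_sublevel:
  assumes "hconvex_set \<Omega>" "hconvex_on \<Omega> u"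
  shows "hconvex_set {g \<in> \<Omega>. u g \<le> M}"
proof -
  have "u (g \<odot> (l * a, l * b, 0)) \<le> M"
    if "g \<in> \<Omega>" "u g \<le> M" "g \<odot> (a, b, 0) \<in> \<Omega>" "u (g \<odot> (a, b, 0)) \<le> M" "l \<in> {0..1}" for g a b l
  proof -
    have "u (g \<odot> (l * a, l * b, 0)) \<le> u g + l * (u (g \<odot> (a, b, 0)) - u g)"
      using assms(2) that unfolding hconvex_on_iff by blast
    also have "\<dots> = (1 - l) * u g + l * u (g \<odot> (a, b, 0))"
      by (simp add: algebra_simps)
    also have "\<dots> \<le> M"
      using that by (intro convex_bound_le) auto
    finally show ?thesis .
  qed
  with assms(1) show ?thesis
    unfolding hconvex_set_iff by auto
qed

text \<open>Horizontal displacements act by right multiplication, so by associativity they commute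
  with left translations; results at \<open>heis_e\<close> thus transfer to every point.\<close>

lemma hconvex_set_left_translate:
  assumes "hconvex_set \<Omega>"
  shows "hconvex_set {g. h \<odot> g \<in> \<Omega>}"
  using assms unfolding hconvex_set_iff by (simp add: flip: heis_mult_assoc)

lemma hconvex_on_left_translate:
  assumes "hconvex_on \<Omega> u"
  shows "hconvex_on {g. h \<odot> g \<in> \<Omega>} (\<lambda>g. u (h \<odot> g))"
  using assms unfolding hconvex_on_iff by (simp add: flip: heis_mult_assoc)

lemma continuous_heis_mult: "continuous_on UNIV (\<lambda>g. h \<odot> g)"
  unfolding heis_mult_def by (cases h) (auto simp: case_prod_beta intro!: continuous_intros)

lemma open_left_translate:
  assumes "open \<Omega>"
  shows "open {g. h \<odot> g \<in> \<Omega>}"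
  using open_vimage[OF assms continuous_heis_mult[of h]] by (simp add: vimage_def)

section \<open>Boxes spanned by finitely many points, and local upper bounds\<close>

lemma open_contains_box:
  fixes \<Omega> :: "heis set"
  assumes "open \<Omega>" "heis_e \<in> \<Omega>"
  obtains r where "r > 0" "r \<le> 1"
    "\<And>x y t. \<bar>x\<bar> \<le> r \<Longrightarrow> \<bar>y\<bar> \<le> r \<Longrightarrow> \<bar>t\<bar> \<le> r \<Longrightarrow> (x, y, t) \<in> \<Omega>"
proof -
  obtain d where d: "d > 0" "ball heis_e d \<subseteq> \<Omega>"
    using assms open_contains_ball by blast
  have "(x, y, t) \<in> \<Omega>" if "\<bar>x\<bar> \<le> min 1 (d/4)" "\<bar>y\<bar> \<le> min 1 (d/4)" "\<bar>t\<bar> \<le> min 1 (d/4)" for x y t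
  proof -
    have "norm (x, y, t) \<le> norm x + (norm y + norm t)"
      using norm_Pair_le[of x "(y, t)"] norm_Pair_le[of y t] by simp
    also have "\<dots> < d"
      using that d by (simp only: real_norm_def)
    finally show ?thesis
      using d(2) by (auto simp: heis_e_eq_zero dist_norm)
  qed
  then show ?thesis
    using that[of "min 1 (d/4)"] d by simp
qed

text \<open>
  The two horizontal edges \<open>(r, \<plusminus>e, \<plusminus>2 e r)\<close> contain the endpoints of a horizontal segment whose
  midpoint is \<open>(0, 0, 2 e r)\<close>.
\<close>

lemma hconvex_set_vertical:
  assumes S: "hconvex_set S" and e: "e > 0"
    and corners: "\<And>s k. s \<in> {-1, 1} \<Longrightarrow> k \<in> {-1, 1} \<Longrightarrow> c \<odot> (s * e, k * e, 2 * s * k * e\<^sup>2) \<in> S"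
    and t: "\<bar>t\<bar> \<le> 2 * e\<^sup>2"
  shows "c \<odot> (0, 0, t) \<in> S"
proof -
  obtain x0 y0 t0 where c: "c = (x0, y0, t0)" by (cases c)
  define s where "s = t / (2 * e\<^sup>2)"
  have t_eq: "t = 2 * e\<^sup>2 * s" and s: "\<bar>s\<bar> \<le> 1"
    using e t by (simp_all add: s_def)
  have edge: "c \<odot> (r * e, k * e, 2 * k * r * e\<^sup>2) \<in> S" if "k \<in> {-1, 1}" "\<bar>r\<bar> \<le> 1" for r k
  proof -
    have "c \<odot> (0, k * e, 0) \<odot> (r * e, r * 0, 0) \<in> S"
      using corners[of 1 k] corners[of "-1" k] that
      by (intro hconvex_set_segment[OF S]) (auto simp: c algebra_simps power2_eq_square)
    then show ?thesis
      by (simp add: c algebra_simps power2_eq_square)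
  qed
  \<comment> \<open>The point at \<open>s\<close> on the edge \<open>k = 1\<close> and the point at
    \<open>-s\<close> on the edge \<open>k = -1\<close> have the same height \<open>t\<close>; the
    factor 0 selects their midpoint.\<close>
  have "c \<odot> (0, 0, t) \<odot> (0 * (s * e), 0 * e, 0) \<in> S"
    using edge[of 1 s] edge[of "-1" "-s"] s
    by (intro hconvex_set_segment[OF S]) (auto simp: c t_eq algebra_simps)
  then show ?thesis
    by (simp add: c)
qed

text \<open>The corners give vertical intervals over both points
  \<open>c \<odot> (0, j * e, 0)\<close>. Vertical displacements are central, so points of equal
  height on the two intervals are joined by a horizontal segment parallel to
  \<open>Y\<close>.\<close>

lemma hconvex_set_vertical_strip:
  assumes S: "hconvex_set S" and e: "e > 0"
    and corners: "\<And>s k j. s \<in> {-1, 1} \<Longrightarrow> k \<in> {-1, 1} \<Longrightarrow> j \<in> {-1, 1} \<Longrightarrow>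
      c \<odot> (0, j * e, 0) \<odot> (s * e, k * e, 2 * s * k * e\<^sup>2) \<in> S"
    and y: "\<bar>y\<bar> \<le> e" and t: "\<bar>t\<bar> \<le> 2 * e\<^sup>2"
  shows "c \<odot> (0, y, t) \<in> S"
proof -
  obtain x0 y0 t0 where c: "c = (x0, y0, t0)" by (cases c)
  have ends: "c \<odot> (0, j * e, 0) \<odot> (0, 0, t) \<in> S" if "j \<in> {-1, 1}" for j
    using hconvex_set_vertical[OF S e _ t, of "c \<odot> (0, j * e, 0)"] corners that by blast
  have "c \<odot> (0, 0, t) \<odot> (y / e * 0, y / e * e, 0) \<in> S"
    using ends[of 1] ends[of "-1"] y e
    by (intro hconvex_set_segment[OF S]) (auto simp: c algebra_simps)
  then show ?thesis
    using e by (simp add: c algebra_simps)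
qed

text \<open>
  Two vertical strips in the planes \<open>x = \<plusminus>e\<close>, each spanned by eight points, are joined by
  horizontal segments parallel to \<open>X\<close>, and these fill a box.
\<close>

definition box_generators :: "real \<Rightarrow> heis set" where
  "box_generators e = (\<lambda>(i, j, s, k).
     (i * e, 0, 0) \<odot> (0, j * e, 0) \<odot> (s * e, k * e, 2 * s * k * e\<^sup>2)) `
     ({-1, 1} \<times> {-1, 1} \<times> {-1, 1} \<times> {-1, 1})"

lemma finite_box_generators: "finite (box_generators e)"
  by (simp add: box_generators_def)

text \<open>The last coordinate is a sum of four terms of size \<open>2 * e\<^sup>2\<close>, whence
  the 8.\<close>

lemma box_generators_bound:
  assumes "(x, y, t) \<in> box_generators e" "0 < e" "e \<le> 1"
  shows "\<bar>x\<bar> \<le> 8 * e" "\<bar>y\<bar> \<le> 8 * e" "\<bar>t\<bar> \<le> 8 * e"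
proof -
  have "e\<^sup>2 \<le> e" "e\<^sup>2 \<ge> 0"
    using assms(2,3) by (simp_all add: power2_eq_square mult_left_le)
  with assms show "\<bar>x\<bar> \<le> 8 * e" "\<bar>y\<bar> \<le> 8 * e" "\<bar>t\<bar> \<le> 8 * e"
    by (auto simp: box_generators_def power2_eq_square)
qed

lemma hconvex_set_contains_box:
  assumes S: "hconvex_set S" and e: "e > 0" and gen: "box_generators e \<subseteq> S"
    and x: "\<bar>x\<bar> \<le> e" and y: "\<bar>y\<bar> \<le> e / 6" and t: "\<bar>t\<bar> \<le> e\<^sup>2"
  shows "(x, y, t) \<in> S"
proof -
  have strip: "(i * e, 0, 0) \<odot> (0, y', t') \<in> S"
    if "i \<in> {-1, 1}" "\<bar>y'\<bar> \<le> e" "\<bar>t'\<bar> \<le> 2 * e\<^sup>2" for i y' t'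
  proof (rule hconvex_set_vertical_strip[OF S e _ that(2,3)])
    fix s k j :: real
    assume "s \<in> {-1, 1}" "k \<in> {-1, 1}" "j \<in> {-1, 1}"
    with that(1) show "(i * e, 0, 0) \<odot> (0, j * e, 0) \<odot> (s * e, k * e, 2 * s * k * e\<^sup>2) \<in> S"
      by (intro subsetD[OF gen[unfolded box_generators_def]] image_eqI[of _ _ "(i, j, s, k)"])
         (simp, intro SigmaI)
  qed
  \<comment> \<open>The line through \<open>(x, y, t)\<close> parallel to \<open>X\<close> meets the
    plane of first coordinate \<open>i * e\<close> at this height, measured in the strip. The bound
    \<open>e / 6\<close> keeps the shift within \<open>e\<^sup>2\<close>.\<close>
  have shift: "\<bar>t + 2 * y * (2 * i * e - x)\<bar> \<le> 2 * e\<^sup>2" if "i \<in> {-1, 1}" for i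
  proof -
    have "\<bar>2 * y * (2 * i * e - x)\<bar> = 2 * \<bar>y\<bar> * \<bar>2 * i * e - x\<bar>"
      by (simp add: abs_mult)
    also have "\<dots> \<le> 2 * (e / 6) * (3 * e)"
      using x y e that by (intro mult_mono) auto
    finally show ?thesis
      using t by (simp add: power2_eq_square)
  qed
  have y': "\<bar>y\<bar> \<le> e"
    using y e by linarith
  \<comment> \<open>The base point is where that line crosses the plane of first coordinate
    0.\<close>
  have "(0, y, t - 2 * x * y) \<odot> (x / e * e, x / e * 0, 0) \<in> S"
  proof (rule hconvex_set_segment[OF S])
    show "(0, y, t - 2 * x * y) \<odot> (e, 0, 0) \<in> S"
      using strip[OF _ y' shift, of 1 1] by (simp add: algebra_simps)
    show "(0, y, t - 2 * x * y) \<odot> (- e, - 0, 0) \<in> S"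
      using strip[OF _ y' shift, of "-1" "-1"] by (simp add: algebra_simps)
    show "\<bar>x / e\<bar> \<le> 1"
      using x e by simp
  qed
  then show ?thesis
    using e by (simp add: algebra_simps)
qed

text \<open>Sublevel sets are convex, so the maximum of \<open>u\<close> over the finitely many
  generators bounds \<open>u\<close> on the whole box that they span.\<close>

lemma hconvex_on_bounded_above:
  assumes "open \<Omega>" "hconvex_set \<Omega>" "hconvex_on \<Omega> u" "heis_e \<in> \<Omega>"
  obtains r M where "r > 0" "r \<le> 1"
    "\<And>x y t. \<bar>x\<bar> \<le> r \<Longrightarrow> \<bar>y\<bar> \<le> r \<Longrightarrow> \<bar>t\<bar> \<le> r \<Longrightarrow> (x, y, t) \<in> \<Omega> \<and> u (x, y, t) \<le> M"
proof -
  obtain d where d: "d > 0" "d \<le> 1"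
    "\<And>x y t. \<bar>x\<bar> \<le> d \<Longrightarrow> \<bar>y\<bar> \<le> d \<Longrightarrow> \<bar>t\<bar> \<le> d \<Longrightarrow> (x, y, t) \<in> \<Omega>"
    using open_contains_box[OF assms(1,4)] by metis
  define e where "e = d / 8"
  have e: "e > 0" "e \<le> 1" "8 * e = d"
    using d by (auto simp: e_def)
  define M where "M = Max (u ` box_generators e)"
  have "g \<in> \<Omega> \<and> u g \<le> M" if "g \<in> box_generators e" for g
    using box_generators_bound[of _ _ _ e] d(3) e that finite_box_generators[of e]
    by (cases g) (auto simp: M_def)
  then have gen: "box_generators e \<subseteq> {g \<in> \<Omega>. u g \<le> M}"
    by blast
  define r where "r = min (e / 6) (e\<^sup>2)"
  have r: "r > 0" "r \<le> 1" "r \<le> e" "r \<le> e / 6" "r \<le> e\<^sup>2"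
    using e by (auto simp: r_def)
  have "(x, y, t) \<in> \<Omega> \<and> u (x, y, t) \<le> M" if "\<bar>x\<bar> \<le> r" "\<bar>y\<bar> \<le> r" "\<bar>t\<bar> \<le> r" for x y t
    using hconvex_set_contains_box[OF hconvex_set_sublevel[OF assms(2,3)] e(1) gen, of x y t] that r
    by auto
  with that r show ?thesis
    by blast
qed

section \<open>Harnack inequality and continuity\<close>

text \<open>
  Convexity along one horizontal line turns the upper bound \<open>M\<close> into a Harnack inequality for
  \<open>M - u\<close>.  Three horizontal steps of length about \<open>l\<close> reach every point of a neighbourhood of
  the identity, so \<open>M - u\<close> changes by a factor close to \<open>1\<close> there.
\<close>

lemma hconvex_on_isCont_e:
  assumes "open \<Omega>" "hconvex_set \<Omega>" "hconvex_on \<Omega> u" "heis_e \<in> \<Omega>"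
  shows "isCont u heis_e"
proof -
  obtain r M where r: "r > 0" "r \<le> 1" and box:
    "\<And>x y t. \<bar>x\<bar> \<le> r \<Longrightarrow> \<bar>y\<bar> \<le> r \<Longrightarrow> \<bar>t\<bar> \<le> r \<Longrightarrow> (x, y, t) \<in> \<Omega> \<and> u (x, y, t) \<le> M"
    using hconvex_on_bounded_above[OF assms] by metis
  define N where "N g = M - u g" for g
  have Nnn: "N (x, y, t) \<ge> 0" if "\<bar>x\<bar> \<le> r" "\<bar>y\<bar> \<le> r" "\<bar>t\<bar> \<le> r" for x y t
    using box[OF that] by (simp add: N_def)
  have prod_le: "\<bar>2 * (a * y - x * b)\<bar> \<le> r / 2"
    if "\<bar>x\<bar> \<le> r / 8" "\<bar>y\<bar> \<le> r / 8" "\<bar>a\<bar> \<le> r / 8" "\<bar>b\<bar> \<le> r / 8" for x y a b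
  proof -
    have "\<bar>a * y\<bar> \<le> (r / 8) * 1" "\<bar>x * b\<bar> \<le> (r / 8) * 1"
      unfolding abs_mult using that r by (intro mult_mono; simp)+
    then have "2 * (\<bar>a * y\<bar> + \<bar>x * b\<bar>) \<le> r / 2"
      by simp
    moreover have "\<bar>2 * (a * y - x * b)\<bar> \<le> 2 * (\<bar>a * y\<bar> + \<bar>x * b\<bar>)"
      unfolding abs_mult[of 2] abs_numeral by (intro mult_left_mono abs_triangle_ineq4) simp
    ultimately show ?thesis
      by (rule order_trans[rotated])
  qed
  have stay: "(x, y, t) \<odot> (a, b, 0) \<in> \<Omega> \<and> u ((x, y, t) \<odot> (a, b, 0)) \<le> M"
    if "\<bar>x\<bar> \<le> r / 8" "\<bar>y\<bar> \<le> r / 8" "\<bar>t\<bar> \<le> r / 8" "\<bar>a\<bar> \<le> r / 8" "\<bar>b\<bar> \<le> r / 8" for x y t a b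
    unfolding heis_mult_simp
  proof (rule box)
    show "\<bar>x + a\<bar> \<le> r" using that(1,4) r(1) by linarith
    show "\<bar>y + b\<bar> \<le> r" using that(2,5) r(1) by linarith
    show "\<bar>t + 0 + 2 * (a * y - x * b)\<bar> \<le> r"
      using that(3) prod_le[OF that(1,2,4,5)] r(1) by linarith
  qed
  have step: "N (g \<odot> (a, b, 0)) \<le> (1 + l) * N g"
    if g: "g = (x, y, t)" "\<bar>x\<bar> \<le> r / 8" "\<bar>y\<bar> \<le> r / 8" "\<bar>t\<bar> \<le> r / 8"
      and l: "0 < l" "l \<le> 1" and ab: "\<bar>a\<bar> \<le> l * (r / 8)" "\<bar>b\<bar> \<le> l * (r / 8)" for g x y t a b l
  proof -
    \<comment> \<open>The displacement is reversed and stretched by \<open>1 / l\<close>, which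
      still fits in the box. At the far point only the bound \<open>M\<close> is needed, and
      \<open>hconvex_on_between\<close> with \<open>m = 1 / l\<close> gives the factor
      \<open>1 + l\<close>.\<close>
    define a' b' where "a' = - (1 / l) * a" and "b' = - (1 / l) * b"
    have a': "\<bar>a'\<bar> \<le> r / 8" "\<bar>b'\<bar> \<le> r / 8"
      using ab l by (simp_all add: a'_def b'_def abs_mult field_simps)
    have "l * (r / 8) \<le> 1 * (r / 8)"
      using l r by (intro mult_right_mono) auto
    then have ab': "\<bar>a\<bar> \<le> r / 8" "\<bar>b\<bar> \<le> r / 8"
      using ab by linarith+
    have in1: "g \<odot> (a, b, 0) \<in> \<Omega>"
      unfolding g(1) using stay[OF g(2-4) ab'] by blast
    have in2: "g \<odot> (a', b', 0) \<in> \<Omega> \<and> u (g \<odot> (a', b', 0)) \<le> M"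
      unfolding g(1) by (rule stay[OF g(2-4) a'])
    have "(1 + 1 / l) * u g \<le> 1 / l * u (g \<odot> (a, b, 0)) + u (g \<odot> (a', b', 0))"
      unfolding a'_def b'_def
      by (rule hconvex_on_between[OF assms(3) in1])
         (use in2 l in \<open>simp_all add: a'_def b'_def\<close>)
    also have "\<dots> \<le> 1 / l * u (g \<odot> (a, b, 0)) + M"
      using in2 by simp
    finally have "l * ((1 + 1 / l) * u g) \<le> l * (1 / l * u (g \<odot> (a, b, 0)) + M)"
      using l by (intro mult_left_mono) auto
    then have "(1 + l) * u g \<le> u (g \<odot> (a, b, 0)) + l * M"
      using l by (simp add: algebra_simps)
    then show ?thesis
      by (simp add: N_def algebra_simps)
  qed
  have steps: "N w \<le> (1 + 7 * l) * N heis_e \<and> N heis_e \<le> (1 + 7 * l) * N w"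
    if l: "0 < l" "l \<le> 1" and w: "w = (x, y, t)"
      "\<bar>x\<bar> \<le> (l * r / 8)\<^sup>2 / 2" "\<bar>y\<bar> \<le> (l * r / 8)\<^sup>2 / 2" "\<bar>t\<bar> \<le> (l * r / 8)\<^sup>2 / 2" for l w x y t
  proof -
    define h where "h = l * r / 8"
    have "l * (r / 8) \<le> 1 * (r / 8)"
      using l r by (intro mult_right_mono) auto
    moreover have h_eq: "h = l * (r / 8)"
      by (simp add: h_def)
    ultimately have "h \<le> r / 8"
      by simp
    moreover have "h > 0"
      using l r by (simp add: h_def)
    ultimately have h: "0 < h" "h \<le> r / 8" "h \<le> 1" "h = l * (r / 8)"
      using h_eq r by linarith+
    have "h\<^sup>2 \<le> h"
      using h by (simp add: power2_eq_square mult_left_le)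
    then have xyt: "\<bar>x\<bar> \<le> h / 2" "\<bar>y\<bar> \<le> h / 2" "\<bar>t\<bar> \<le> h / 2" "\<bar>t\<bar> \<le> h\<^sup>2 / 2"
      using w(2-4) unfolding h_def by linarith+
    \<comment> \<open>The path runs from \<open>heis_e\<close> through \<open>(0, h, 0)\<close> and
      \<open>(z, 0, 2 * h * z)\<close> to \<open>w\<close>. Its final height is
      \<open>2 * z * (h - y)\<close>, so this \<open>z\<close> makes it equal to \<open>t\<close>;
      \<open>h - y\<close> stays at least \<open>h / 2\<close>.\<close>
    define z where "z = t / (2 * (h - y))"
    have hy: "h - y \<ge> h / 2" "h - y > 0"
      using xyt(2) h by (auto simp: abs_le_iff)
    have "\<bar>z\<bar> = \<bar>t\<bar> / (2 * (h - y))"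
      using hy by (simp add: z_def)
    also have "\<dots> \<le> (h\<^sup>2 / 2) / (2 * (h / 2))"
      using xyt(4) hy h(1) by (intro frac_le) auto
    finally have z: "\<bar>z\<bar> \<le> h / 2"
      using h(1) by (simp add: power2_eq_square)
    have "2 * (h - y) * z = t"
      using hy(2) by (simp add: z_def)
    then have tz: "t = 2 * z * h - 2 * z * y"
      by (simp add: algebra_simps)
    have zh: "\<bar>2 * h * z\<bar> \<le> h"
    proof -
      have "\<bar>2 * h * z\<bar> = (2 * \<bar>z\<bar>) * h" using h(1) by (simp add: abs_mult)
      also have "\<dots> \<le> 1 * h" using z h(1,3) by (intro mult_right_mono) auto
      finally show ?thesis by simp
    qed
    define p1 p2 where "p1 = (0::real, h, 0::real)" and "p2 = (z, 0::real, 2 * h * z)"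
    have moves:
      "heis_e \<odot> (0, h, 0) = p1" "p1 \<odot> (z, - h, 0) = p2" "p2 \<odot> (x - z, y, 0) = w"
      "w \<odot> (z - x, - y, 0) = p2" "p2 \<odot> (- z, h, 0) = p1" "p1 \<odot> (0, - h, 0) = heis_e"
      using tz by (simp_all add: p1_def p2_def heis_e_def w(1) algebra_simps)
    have inside: "\<bar>0\<bar> \<le> r / 8" "\<bar>h\<bar> \<le> r / 8" "\<bar>z\<bar> \<le> r / 8" "\<bar>2 * h * z\<bar> \<le> r / 8"
      "\<bar>x\<bar> \<le> r / 8" "\<bar>y\<bar> \<le> r / 8" "\<bar>t\<bar> \<le> r / 8"
      using h(1,2) xyt(1-3) z zh by linarith+
    have small: "\<bar>0\<bar> \<le> l * (r / 8)" "\<bar>h\<bar> \<le> l * (r / 8)" "\<bar>- h\<bar> \<le> l * (r / 8)"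
      "\<bar>z\<bar> \<le> l * (r / 8)" "\<bar>- z\<bar> \<le> l * (r / 8)" "\<bar>x - z\<bar> \<le> l * (r / 8)"
      "\<bar>z - x\<bar> \<le> l * (r / 8)" "\<bar>y\<bar> \<le> l * (r / 8)" "\<bar>- y\<bar> \<le> l * (r / 8)"
      unfolding h(4)[symmetric] using h(1) xyt(1,2) z by linarith+
    have fwd: "N p1 \<le> (1 + l) * N heis_e" "N p2 \<le> (1 + l) * N p1" "N w \<le> (1 + l) * N p2"
      using step[OF heis_e_def inside(1,1,1) l small(1,2)]
        step[OF p1_def inside(1,2,1) l small(4,3)] step[OF p2_def inside(3,1,4) l small(6,8)]
      by (simp_all only: moves)
    have bwd: "N p2 \<le> (1 + l) * N w" "N p1 \<le> (1 + l) * N p2" "N heis_e \<le> (1 + l) * N p1"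
      using step[OF w(1) inside(5,6,7) l small(7,9)]
        step[OF p2_def inside(3,1,4) l small(5,2)] step[OF p1_def inside(1,2,1) l small(1,3)]
      by (simp_all only: moves)
    have nn: "N heis_e \<ge> 0" "N w \<ge> 0"
      unfolding heis_e_def w(1) by (rule Nnn; use inside r(1) in linarith)+
    \<comment> \<open>Three steps cost \<open>(1 + l)^3\<close>, and
      \<open>3 * l + 3 * l^2 + l^3\<close> is at most \<open>7 * l\<close> for \<open>l\<close> in
      the unit interval.\<close>
    have cube: "(1 + l) * ((1 + l) * ((1 + l) * c)) \<le> (1 + 7 * l) * c" if "c \<ge> 0" for c
    proof -
      have "l * l \<le> l" "l * (l * l) \<le> l * 1"
        using l by (auto simp: mult_left_le mult_le_one intro!: mult_left_mono)
      then have "(1 + l) * ((1 + l) * (1 + l)) \<le> 1 + 7 * l"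
        by (simp add: algebra_simps)
      from mult_right_mono[OF this that] show ?thesis
        by (simp add: mult.assoc)
    qed
    have mono: "a \<le> b \<Longrightarrow> (1 + l) * a \<le> (1 + l) * b" for a b
      using l by (intro mult_left_mono) auto
    show ?thesis
      using fwd bwd cube[OF nn(1)] cube[OF nn(2)] by (meson mono order_trans)
  qed
  have Ne: "N heis_e \<ge> 0"
    using r by (auto simp: heis_e_def intro!: Nnn)
  show ?thesis
    unfolding continuous_at_eps_delta
  proof (intro allI impI)
    fix m :: real
    assume m: "m > 0"
    \<comment> \<open>The two-sided estimate and \<open>N w \<le> 8 * N heis_e\<close> bound the
      change by 56 times \<open>l * N heis_e\<close>. Taking 57 and adding 1 makes the inequality
      strict and covers \<open>N heis_e = 0\<close>.\<close>
    define l where "l = min 1 (m / (57 * (N heis_e + 1)))"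
    have l: "0 < l" "l \<le> 1" "l * (57 * (N heis_e + 1)) \<le> m"
    proof -
      show "0 < l" "l \<le> 1" using Ne m by (auto simp: l_def)
      have "l \<le> m / (57 * (N heis_e + 1))" by (simp add: l_def)
      then show "l * (57 * (N heis_e + 1)) \<le> m"
        using Ne by (subst (asm) pos_le_divide_eq) auto
    qed
    have "\<bar>u w - u heis_e\<bar> < m" if d: "dist w heis_e < (l * r / 8)\<^sup>2 / 2" for w
    proof -
      obtain x y t where w: "w = (x, y, t)" by (cases w)
      have "norm w < (l * r / 8)\<^sup>2 / 2"
        using d by (simp add: heis_e_eq_zero dist_norm)
      moreover have "\<bar>x\<bar> \<le> norm w" "\<bar>y\<bar> \<le> norm w" "\<bar>t\<bar> \<le> norm w"
        unfolding w real_norm_def[symmetric]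
        by (rule norm_fst_le order_trans[OF norm_fst_le norm_snd_le]
            order_trans[OF norm_snd_le norm_snd_le])+
      ultimately have *: "N w \<le> (1 + 7 * l) * N heis_e" "N heis_e \<le> (1 + 7 * l) * N w"
        using steps[OF l(1,2) w] by linarith+
      have "(1 + 7 * l) * N heis_e \<le> 8 * N heis_e"
        using l Ne by (intro mult_right_mono) auto
      with *(1) have "N w \<le> 8 * N heis_e" by linarith
      then have "l * N w \<le> l * (8 * N heis_e)"
        using l by (intro mult_left_mono) auto
      moreover have "0 \<le> l * N heis_e" using l Ne by simp
      ultimately have "\<bar>N w - N heis_e\<bar> \<le> 56 * (l * N heis_e)"
        using * by (simp add: abs_le_iff algebra_simps)
      also have "\<dots> < m"
        using l \<open>0 \<le> l * N heis_e\<close> by (simp add: algebra_simps)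
      finally show ?thesis by (simp add: N_def)
    qed
    then show "\<exists>d>0. \<forall>x'. dist x' heis_e < d \<longrightarrow> dist (u x') (u heis_e) < m"
      using l r by (intro exI[of _ "(l * r / 8)\<^sup>2 / 2"]) (auto simp: dist_real_def)
  qed
qed

text \<open>Near \<open>g\<close>, \<open>u\<close> is its left translate, continuous at
  \<open>heis_e\<close>, composed with the translation by \<open>heis_inv g\<close>.\<close>

lemma hconvex_on_continuous_on:
  assumes "open \<Omega>" "hconvex_set \<Omega>" "hconvex_on \<Omega> u"
  shows "continuous_on \<Omega> u"
proof (rule continuous_at_imp_continuous_on, rule ballI)
  fix g assume g: "g \<in> \<Omega>"
  have "isCont (\<lambda>h. u (g \<odot> h)) heis_e"
    using assms g
    by (intro hconvex_on_isCont_e[OF open_left_translate hconvex_set_left_translate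
          hconvex_on_left_translate]) (auto simp: heis_e_right)
  moreover have "isCont (\<lambda>h. heis_inv g \<odot> h) g"
    using continuous_heis_mult continuous_on_eq_continuous_at open_UNIV by blast
  ultimately have "isCont (\<lambda>h. u (g \<odot> (heis_inv g \<odot> h))) g"
    using isCont_o2[of g "\<lambda>h. heis_inv g \<odot> h" "\<lambda>h. u (g \<odot> h)"] by (simp add: heis_inv_left)
  then show "isCont u g"
    by (simp add: heis_mult_inv_cancel)
qed

section \<open>Existence of subgradients\<close>

text \<open>
  At a point where \<open>u + n \<bar>\<cdot>\<bar>\<^sup>2\<close> has a local minimum, \<open>u\<close> is touched from below by a smooth
  function, whose horizontal gradient is then a subgradient of \<open>u\<close> there.
\<close>

lemma subgradient_at_penalised_min:
  fixes u :: "heis \<Rightarrow> real"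
  assumes "open \<Omega>" "hconvex_on \<Omega> u" "g \<in> \<Omega>"
    and min: "\<forall>\<^sub>F h in nhds g. u g + n * (norm g)\<^sup>2 \<le> u h + n * (norm h)\<^sup>2"
  shows "\<exists>p q. \<forall>a b. g \<odot> (a, b, 0) \<in> \<Omega> \<longrightarrow> u (g \<odot> (a, b, 0)) \<ge> u g + p * a + q * b"
proof -
  obtain x y t where g: "g = (x, y, t)" by (cases g)
  \<comment> \<open>Horizontal lines are Euclidean straight lines; \<open>V a b\<close> is the
    direction at \<open>g\<close>.\<close>
  define V where "V a b = (a, b, 2 * (a * y - x * b))" for a b
  have gV: "g \<odot> (s * a, s * b, 0) = g + s *\<^sub>R V a b" for s a b
    by (simp add: g V_def algebra_simps)
  have "u (g \<odot> (a, b, 0)) - u g \<ge> - 2 * n * (g \<bullet> V a b)" if h: "g \<odot> (a, b, 0) \<in> \<Omega>" for a b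
  \<comment> \<open>By convexity the full increment dominates the difference quotient at
    \<open>s\<close>, which minimality bounds below; then \<open>s\<close> tends to 0 from the
    right.\<close>
  proof (rule tendsto_upperbound)
    show "((\<lambda>s. - 2 * n * (g \<bullet> V a b) - n * s * (norm (V a b))\<^sup>2) \<longlongrightarrow>
        - 2 * n * (g \<bullet> V a b)) (at_right 0)"
      by (auto intro!: tendsto_eq_intros)
    have "((\<lambda>s. g + s *\<^sub>R V a b) \<longlongrightarrow> g + 0 *\<^sub>R V a b) (at_right (0::real))"
      by (intro tendsto_intros)
    then have "\<forall>\<^sub>F s in at_right 0. u g + n * (norm g)\<^sup>2 \<le>
        u (g + s *\<^sub>R V a b) + n * (norm (g + s *\<^sub>R V a b))\<^sup>2"
      using min by (intro eventually_compose_filterlim[OF min]) simp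
    moreover have "\<forall>\<^sub>F s in at_right (0::real). 0 < s \<and> s \<le> 1"
      unfolding eventually_at_right_field by (intro exI[of _ 1]) auto
    ultimately show "\<forall>\<^sub>F s in at_right 0.
        - 2 * n * (g \<bullet> V a b) - n * s * (norm (V a b))\<^sup>2 \<le> u (g \<odot> (a, b, 0)) - u g"
    proof eventually_elim
      case (elim s)
      have "u (g + s *\<^sub>R V a b) \<le> u g + s * (u (g \<odot> (a, b, 0)) - u g)"
        using assms(2,3) h elim unfolding hconvex_on_iff gV[symmetric] by auto
      moreover have "(norm (g + s *\<^sub>R V a b))\<^sup>2 =
          (norm g)\<^sup>2 + s * (2 * (g \<bullet> V a b) + s * (norm (V a b))\<^sup>2)"
        by (simp add: power2_norm_eq_inner inner_simps inner_commute algebra_simps)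
      ultimately have "s * (- n * (2 * (g \<bullet> V a b) + s * (norm (V a b))\<^sup>2))
          \<le> s * (u (g \<odot> (a, b, 0)) - u g)"
        using elim by (simp add: algebra_simps)
      then have "- n * (2 * (g \<bullet> V a b) + s * (norm (V a b))\<^sup>2) \<le> u (g \<odot> (a, b, 0)) - u g"
        using elim by (simp only: mult_le_cancel_left_pos)
      then show ?case
        by (simp add: algebra_simps)
    qed
  qed simp
  moreover have "g \<bullet> V a b = (x + 2 * t * y) * a + (y - 2 * t * x) * b" for a b
    by (simp add: g V_def algebra_simps)
  ultimately show ?thesis
    by (intro exI[of _ "- 2 * n * (x + 2 * t * y)"] exI[of _ "- 2 * n * (y - 2 * t * x)"])
       (force simp: algebra_simps)
qed

text \<open>Subgradients at points tending to the identity suffice: their slopes are bounded, and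
  continuity of \<open>u\<close> lets the inequalities pass to a limit.\<close>

lemma hconvex_on_subgradient_e:
  assumes \<Omega>: "open \<Omega>" "hconvex_set \<Omega>" and u: "hconvex_on \<Omega> u" and e: "heis_e \<in> \<Omega>"
  shows "\<exists>p q. \<forall>a b. (a, b, 0) \<in> \<Omega> \<longrightarrow> u (a, b, 0) \<ge> u heis_e + p * a + q * b"
proof -
  have cont: "continuous_on \<Omega> u"
    by (rule hconvex_on_continuous_on[OF \<Omega> u])
  obtain d where d: "d > 0" "cball 0 d \<subseteq> \<Omega>"
    using \<Omega>(1) e open_contains_cball heis_e_eq_zero by metis
  have cont_K: "continuous_on (cball 0 d) u"
    using cont d(2) continuous_on_subset by blast
  obtain B where B: "\<And>g. g \<in> cball 0 d \<Longrightarrow> \<bar>u g\<bar> \<le> B"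
    using compact_imp_bounded[OF compact_continuous_image[OF cont_K compact_cball]]
    unfolding bounded_real by blast
  have "\<exists>g\<in>cball 0 d. \<forall>h\<in>cball 0 d.
      u g + real (Suc n) * (norm g)\<^sup>2 \<le> u h + real (Suc n) * (norm h)\<^sup>2" for n
    using d(1) by (intro continuous_attains_inf) (auto intro!: continuous_intros cont_K)
  then obtain G where G: "\<And>n. G n \<in> cball 0 d" and G_min: "\<And>n h. h \<in> cball 0 d \<Longrightarrow>
      u (G n) + real (Suc n) * (norm (G n))\<^sup>2 \<le> u h + real (Suc n) * (norm h)\<^sup>2"
    by metis
  have "(\<lambda>n. (norm (G n))\<^sup>2) \<longlonglongrightarrow> 0"
  proof (rule tendsto_sandwich[OF _ _ tendsto_const])
    show "(\<lambda>n. 2 * B * inverse (real (Suc n))) \<longlonglongrightarrow> 0"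
      using tendsto_mult_right_zero[OF LIMSEQ_inverse_real_of_nat] .
    \<comment> \<open>Comparing the minimum with the value at 0 leaves only the oscillation of
      \<open>u\<close>, at most \<open>2 * B\<close>.\<close>
    have "(norm (G n))\<^sup>2 \<le> 2 * B * inverse (real (Suc n))" for n
    proof -
      have "real (Suc n) * (norm (G n))\<^sup>2 \<le> u 0 - u (G n)"
        using G_min[of 0 n] d(1) by simp
      also have "\<dots> \<le> 2 * B"
        using B[of 0] B[OF G[of n]] d(1) by simp
      finally show ?thesis
        by (simp add: field_simps)
    qed
    then show "\<forall>\<^sub>F n in sequentially. (norm (G n))\<^sup>2 \<le> 2 * B * inverse (real (Suc n))"
      by simp
  qed simp
  then have "G \<longlonglongrightarrow> 0"
    using tendsto_real_sqrt[of "\<lambda>n. (norm (G n))\<^sup>2" 0 sequentially]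
    by (simp add: tendsto_norm_zero_iff)
  then have G_mult: "(\<lambda>n. G n \<odot> (a, b, 0)) \<longlonglongrightarrow> (a, b, 0)" for a b
  proof -
    have "(\<lambda>n. (fst (G n) + a, fst (snd (G n)) + b,
        snd (snd (G n)) + 2 * (a * fst (snd (G n)) - fst (G n) * b))) \<longlonglongrightarrow>
        (fst (0 :: heis) + a, fst (snd (0 :: heis)) + b,
        snd (snd (0 :: heis)) + 2 * (a * fst (snd (0 :: heis)) - fst (0 :: heis) * b))"
      by (intro tendsto_intros \<open>G \<longlonglongrightarrow> 0\<close>)
    then show ?thesis
      by (simp add: heis_mult_def case_prod_beta)
  qed
  have near: "\<forall>\<^sub>F n in sequentially. G n \<odot> (a, b, 0) \<in> ball 0 d"
    if "(a, b, 0) \<in> ball (0 :: heis) d" for a b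
    using topological_tendstoD[OF G_mult open_ball that] .
  \<comment> \<open>Displacements of length \<open>c\<close> along both axes, with either sign,
    eventually stay in the ball; testing a subgradient on them bounds its slopes.\<close>
  define c where "c = d / 2"
  have c: "c > 0" "(c, 0, 0) \<in> ball (0 :: heis) d" "(- c, 0, 0) \<in> ball (0 :: heis) d"
    "(0, c, 0) \<in> ball (0 :: heis) d" "(0, - c, 0) \<in> ball (0 :: heis) d"
    using d(1) by (simp_all add: c_def norm_Pair)
  have "\<forall>\<^sub>F n in sequentially. \<exists>p q. \<bar>p\<bar> \<le> 2 * B / c \<and> \<bar>q\<bar> \<le> 2 * B / c \<and>
      (\<forall>a b. G n \<odot> (a, b, 0) \<in> \<Omega> \<longrightarrow> u (G n \<odot> (a, b, 0)) \<ge> u (G n) + p * a + q * b)"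
    using near[OF c(2)] near[OF c(3)] near[OF c(4)] near[OF c(5)]
      topological_tendstoD[OF \<open>G \<longlonglongrightarrow> 0\<close> open_ball, of 0 d, simplified, OF d(1)]
  proof eventually_elim
    case (elim n)
    \<comment> \<open>Eventually \<open>G n\<close> is interior to the ball, so the constrained
      minimum is a local one.\<close>
    have "\<forall>\<^sub>F h in nhds (G n).
        u (G n) + real (Suc n) * (norm (G n))\<^sup>2 \<le> u h + real (Suc n) * (norm h)\<^sup>2"
      using G_min elim(5) by (intro eventually_nhds_in_open[THEN eventually_mono, of "ball 0 d"]) auto
    moreover have "G n \<in> \<Omega>"
      using G d(2) by blast
    ultimately have "\<exists>p q. \<forall>a b. G n \<odot> (a, b, 0) \<in> \<Omega> \<longrightarrow>
        u (G n \<odot> (a, b, 0)) \<ge> u (G n) + p * a + q * b"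
      by (intro subgradient_at_penalised_min[OF \<Omega>(1) u])
    then obtain p q where pq: "\<And>a b. G n \<odot> (a, b, 0) \<in> \<Omega> \<Longrightarrow>
        u (G n \<odot> (a, b, 0)) \<ge> u (G n) + p * a + q * b"
      by blast
    have "p * a + q * b \<le> 2 * B" if "G n \<odot> (a, b, 0) \<in> ball 0 d" for a b
    proof -
      have in_K: "G n \<odot> (a, b, 0) \<in> cball 0 d"
        using that by (rule subsetD[OF ball_subset_cball])
      then show ?thesis
        using pq[OF subsetD[OF d(2) in_K]] B[OF in_K] B[OF G[of n]] by linarith
    qed
    from this[OF elim(1)] this[OF elim(2)] this[OF elim(3)] this[OF elim(4)]
    have "\<bar>p\<bar> \<le> 2 * B / c" "\<bar>q\<bar> \<le> 2 * B / c"
      using c(1) by (simp_all add: abs_le_iff field_simps)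
    with pq show ?case
      by blast
  qed
  then obtain N where "\<And>n. n \<ge> N \<Longrightarrow> \<exists>p q. \<bar>p\<bar> \<le> 2 * B / c \<and> \<bar>q\<bar> \<le> 2 * B / c \<and>
      (\<forall>a b. G n \<odot> (a, b, 0) \<in> \<Omega> \<longrightarrow> u (G n \<odot> (a, b, 0)) \<ge> u (G n) + p * a + q * b)"
    unfolding eventually_sequentially by blast
  then have "\<exists>p q. \<bar>p\<bar> \<le> 2 * B / c \<and> \<bar>q\<bar> \<le> 2 * B / c \<and>
      (\<forall>a b. G (n + N) \<odot> (a, b, 0) \<in> \<Omega> \<longrightarrow>
         u (G (n + N) \<odot> (a, b, 0)) \<ge> u (G (n + N)) + p * a + q * b)" for n
    by simp
  then obtain P Q where PQ_bound: "\<And>n. \<bar>P n\<bar> \<le> 2 * B / c" "\<And>n. \<bar>Q n\<bar> \<le> 2 * B / c"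
    and PQ: "\<And>n a b. G (n + N) \<odot> (a, b, 0) \<in> \<Omega> \<Longrightarrow>
      u (G (n + N) \<odot> (a, b, 0)) \<ge> u (G (n + N)) + P n * a + Q n * b"
    by metis
  have "bounded (range P \<times> range Q)"
    using PQ_bound by (intro bounded_Times) (auto simp: bounded_real)
  then have "bounded (range (\<lambda>n. (P n, Q n)))"
    by (rule bounded_subset) auto
  then obtain l r where r: "strict_mono r" and lim: "((\<lambda>n. (P n, Q n)) \<circ> r) \<longlonglongrightarrow> l"
    using bounded_imp_convergent_subsequence by blast
  have lims: "(\<lambda>n. P (r n)) \<longlonglongrightarrow> fst l" "(\<lambda>n. Q (r n)) \<longlonglongrightarrow> snd l"
    using tendsto_fst[OF lim] tendsto_snd[OF lim] by (simp_all add: o_def)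
  have sub: "filterlim (\<lambda>n. r n + N) sequentially sequentially"
    using filterlim_compose[OF filterlim_add_const_nat_at_top filterlim_subseq[OF r]] .
  have "u (a, b, 0) \<ge> u heis_e + fst l * a + snd l * b" if h: "(a, b, 0) \<in> \<Omega>" for a b
  proof (rule tendsto_le[OF sequentially_bot])
    have u_lim: "(\<lambda>n. u (H n)) \<longlonglongrightarrow> u x" if "H \<longlonglongrightarrow> x" "x \<in> \<Omega>" for H x
      using cont \<Omega>(1) that continuous_on_eq_continuous_at isCont_tendsto_compose by blast
    have G_lim: "(\<lambda>n. G (r n + N) \<odot> (a, b, 0)) \<longlonglongrightarrow> (a, b, 0)"
      using filterlim_compose[OF G_mult sub] .
    show "(\<lambda>n. u (G (r n + N) \<odot> (a, b, 0))) \<longlonglongrightarrow> u (a, b, 0)"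
      by (rule u_lim[OF G_lim h])
    have "(\<lambda>n. u (G (r n + N))) \<longlonglongrightarrow> u heis_e"
      using u_lim[OF filterlim_compose[OF \<open>G \<longlonglongrightarrow> 0\<close> sub]] e by (simp add: heis_e_eq_zero)
    then show "(\<lambda>n. u (G (r n + N)) + P (r n) * a + Q (r n) * b)
        \<longlonglongrightarrow> u heis_e + fst l * a + snd l * b"
      by (intro tendsto_intros lims)
    \<comment> \<open>For fixed \<open>a\<close>, \<open>b\<close> the translated points converge to
      \<open>(a, b, 0)\<close>, hence eventually lie in the open set, where the inequality
      applies.\<close>
    show "\<forall>\<^sub>F n in sequentially.
        u (G (r n + N)) + P (r n) * a + Q (r n) * b \<le> u (G (r n + N) \<odot> (a, b, 0))"
      using topological_tendstoD[OF G_lim \<Omega>(1) h] by eventually_elim (rule PQ)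
  qed
  then show ?thesis
    by blast
qed

section \<open>The two implications at arbitrary points\<close>

lemma hconvex_on_imp_hsubdiff_nonempty:
  assumes "open \<Omega>" "hconvex_set \<Omega>" "hconvex_on \<Omega> u" "g \<in> \<Omega>"
  shows "hsubdiff \<Omega> u g \<noteq> {}"
proof -
  have "\<exists>p q. \<forall>a b. (a, b, 0) \<in> {h. g \<odot> h \<in> \<Omega>} \<longrightarrow>
      u (g \<odot> (a, b, 0)) \<ge> u (g \<odot> heis_e) + p * a + q * b"
    using assms
    by (intro hconvex_on_subgradient_e[OF open_left_translate hconvex_set_left_translate
          hconvex_on_left_translate]) (auto simp: heis_e_right)
  then show ?thesis
    unfolding hsubdiff_nonempty_iff by (simp add: heis_e_right)
qed

text \<open>Seen from the intermediate point \<open>w\<close>, the ends have displacements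
  \<open>- l\<close> and \<open>1 - l\<close> times \<open>(a, b)\<close>. Weighting the two
  subgradient inequalities by \<open>1 - l\<close> and \<open>l\<close> cancels the slopes.\<close>

lemma hsubdiff_nonempty_imp_hconvex_on:
  assumes "hconvex_set \<Omega>" "\<forall>g\<in>\<Omega>. hsubdiff \<Omega> u g \<noteq> {}"
  shows "hconvex_on \<Omega> u"
  unfolding hconvex_on_iff
proof (intro ballI allI impI)
  fix g a b and l :: real
  assume g: "g \<in> \<Omega>" "g \<odot> (a, b, 0) \<in> \<Omega>" and l: "l \<in> {0..1}"
  define w where "w = g \<odot> (l * a, l * b, 0)"
  have "w \<in> \<Omega>"
    using assms(1) g l unfolding hconvex_set_iff w_def by blast
  then obtain p q where pq: "\<And>a b. w \<odot> (a, b, 0) \<in> \<Omega> \<Longrightarrow> u (w \<odot> (a, b, 0)) \<ge> u w + p * a + q * b"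
    using assms(2) unfolding hsubdiff_nonempty_iff by metis
  have "w \<odot> (- l * a, - l * b, 0) = g" "w \<odot> ((1 - l) * a, (1 - l) * b, 0) = g \<odot> (a, b, 0)"
    by (cases g; simp add: w_def algebra_simps)+
  with pq[of "- l * a" "- l * b"] pq[of "(1 - l) * a" "(1 - l) * b"] g
  have "u g \<ge> u w - l * (p * a + q * b)"
    "u (g \<odot> (a, b, 0)) \<ge> u w + (1 - l) * (p * a + q * b)"
    by (simp_all add: algebra_simps)
  then have "(1 - l) * u g + l * u (g \<odot> (a, b, 0)) \<ge>
      (1 - l) * (u w - l * (p * a + q * b)) + l * (u w + (1 - l) * (p * a + q * b))"
    using l by (intro add_mono mult_left_mono) auto
  then show "u (g \<odot> (l * a, l * b, 0)) \<le> u g + l * (u (g \<odot> (a, b, 0)) - u g)"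
    unfolding w_def[symmetric] by (simp add: algebra_simps)
qed

theorem theorem4p1:
  fixes \<Omega> :: "heis set" and u :: "heis \<Rightarrow> real"
  assumes "open \<Omega>" and "hconvex_set \<Omega>"
  shows "hconvex_on \<Omega> u \<longleftrightarrow> (\<forall>g\<in>\<Omega>. hsubdiff \<Omega> u g \<noteq> {})"
  using assms hconvex_on_imp_hsubdiff_nonempty hsubdiff_nonempty_imp_hconvex_on by blast

end
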